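(* Let $n,m\ge 1$, let $c_1,\dots,c_n\ge 0$ be the flux capacities of the incoming roads of a junction and $c_{n+1},\dots,c_{n+m}>0$ those of its outgoing roads, and let $A=(\alpha_{ji})_{j=n+1,\dots,n+m;\ i=1,\dots,n}$ be a traffic distribution matrix (as defined in the context). For $1\le j\le m$ let $A_j$ be the $j$th row of $A$ and put $$r_j:=c_{n+j}^{-1}A_j\begin{pmatrix}c_1\\ \vdots\\ c_n\end{pmatrix},\qquad r:=\max_{1\le j\le m}r_j,\qquad c_{\mathrm{in}}=\sum_{i=1}^n c_i,\qquad c_{\mathrm{out}}=\sum_{j=n+1}^{n+m}c_j .$$ Then the junction optimization problem described in the context has a unique solution, given as follows. (i) If $r\le 1$, then $$\begin{pmatrix}\hat\gamma_1\\ \vdots\\ \hat\gamma_n\end{pmatrix}=\begin{pmatrix}c_1\\ \vdots\\ c_n\end{pmatrix}\quad\text{and}\quad \begin{pmatrix}\hat\gamma_{n+1}\\ \vdots\\ \hat\gamma_{n+m}\end{pmatrix}=A\begin{pmatrix}\hat\gamma_1\\ \vdots\\ \hat\gamma_n\end{pmatrix}.$$ (ii) If $r>1$ and $c_{\mathrm{in}}\le c_{\mathrm{out}}$, then $\mu=1$, $\lambda=\frac{c_{\mathrm{in}}}{c_{\mathrm{out}}}$, and $$\begin{pmatrix}\hat\gamma_1\\ \vdots\\ \hat\gamma_n\end{pmatrix}=\begin{pmatrix}c_1\\ \vdots\\ c_n\end{pmatrix}\quad\text{and}\quad \begin{pmatrix}\hat\gamma_{n+1}\\ \vdots\\ \hat\gamma_{n+m}\end{pmatrix}=\frac{c_{\mathrm{in}}}{c_{\mathrm{out}}}\begin{pmatrix}c_{n+1}\\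 \vdots\\ c_{n+m}\end{pmatrix}.$$ (iii) If $r>1$ and $c_{\mathrm{in}}>c_{\mathrm{out}}$, then $\mu=\frac{c_{\mathrm{out}}}{c_{\mathrm{in}}}$, $\lambda=1$, and $$\begin{pmatrix}\hat\gamma_1\\ \vdots\\ \hat\gamma_n\end{pmatrix}=\frac{c_{\mathrm{out}}}{c_{\mathrm{in}}}\begin{pmatrix}c_1\\ \vdots\\ c_n\end{pmatrix}\quad\text{and}\quad \begin{pmatrix}\hat\gamma_{n+1}\\ \vdots\\ \hat\gamma_{n+m}\end{pmatrix}=\begin{pmatrix}c_{n+1}\\ \vdots\\ c_{n+m}\end{pmatrix}.$$
   Context: A junction has $n$ incoming roads (indices $1,\dots,n$) and $m$ outgoing roads (indices $n+1,\dots,n+m$). Road $i$ has flux capacity $c_i$, and the admissible set of junction fluxes is $\Omega=\prod_{i=1}^{n+m}[0,c_i]$. A traffic distribution matrix is $A=(\alpha_{ji})\in\mathbb{R}^{m\times n}$, $j=n+1,\dots,n+m$, $i=1,\dots,n$, with $0<\alpha_{ji}<1$ and $\sum_{j=n+1}^{n+m}\alpha_{ji}=1$ for every $i$. It is moreover assumed that the row vector $(1,\dots,1)\in\mathbb{R}^n$ is not in the span of any $n-1$ vectors chosen among the rows of $A$ and the standard basis vectors of $\mathbb{R}^n$. The junction optimization problem for the fluxes $(\hat\gamma_1,\dots,\hat\gamma_{n+m})$ is the following. Call the junction "packed" if for at least one $j\in\{1,\dots,m\}$ one has $c_{n+j}<\big(A(c_1,\dots,c_n)^T\big)_j$. (a)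 If the junction is not packed: maximize $\sum_{i=1}^n\hat\gamma_i$ over $(\hat\gamma_1,\dots,\hat\gamma_{n+m})\in\Omega$ subject to $(\hat\gamma_{n+1},\dots,\hat\gamma_{n+m})^T=A(\hat\gamma_1,\dots,\hat\gamma_n)^T$. (b) If the junction is packed: maximize $\sum_{i=1}^n\hat\gamma_i$ over $(\lambda,\mu)\in[0,1]^2$, where the fluxes are given by the right-of-way rule $(\hat\gamma_1,\dots,\hat\gamma_n)^T=\mu(c_1,\dots,c_n)^T$ and $(\hat\gamma_{n+1},\dots,\hat\gamma_{n+m})^T=\lambda(c_{n+1},\dots,c_{n+m})^T$, subject to the Kirchhoff law $\sum_{i=1}^n\hat\gamma_i=\sum_{j=n+1}^{n+m}\hat\gamma_j$. *)

theory Defs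
  imports "HOL-Analysis.Analysis"
begin

text \<open>The incoming roads are indexed by the finite type \<open>'n\<close>, the outgoing roads by the finite
  type \<open>'m\<close>; a family over all roads is a vector over the index type \<open>'n + 'm\<close>. A matrix
  of type \<open>real^'n^'m\<close> has rows indexed by outgoing and columns by incoming roads.\<close>

definition incoming :: "real^('n::finite + 'm::finite) \<Rightarrow> real^'n" where
  "incoming \<gamma> = (\<chi> i. \<gamma> $ Inl i)"

definition outgoing :: "real^('n::finite + 'm::finite) \<Rightarrow> real^'m" where
  "outgoing \<gamma> = (\<chi> j. \<gamma> $ Inr j)"

definition total_in :: "real^('n::finite + 'm::finite) \<Rightarrow> real" where
  "total_in \<gamma> = (\<Sum>i\<in>UNIV. incoming \<gamma> $ i)"

definition total_out :: "real^('n::finite + 'm::finite) \<Rightarrow> real" where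
  "total_out \<gamma> = (\<Sum>j\<in>UNIV. outgoing \<gamma> $ j)"

definition admissible_fluxes :: "real^('n::finite + 'm::finite) \<Rightarrow> (real^('n + 'm)) set" where
  "admissible_fluxes c = {\<gamma>. \<forall>k. \<gamma> $ k \<in> {0..c $ k}}"

text \<open>In the last condition a choice of vectors is a set of distinct vectors. Allowing repetitions
  gives the same condition: there are at least \<open>CARD('n)\<close> distinct vectors to choose from, so a
  choice with repetitions extends to one without.\<close>

definition traffic_distribution_matrix :: "real^'n::finite^'m::finite \<Rightarrow> bool" where
  "traffic_distribution_matrix A \<longleftrightarrow>
     (\<forall>j i. 0 < A $ j $ i \<and> A $ j $ i < 1) \<and>
     (\<forall>i. (\<Sum>j\<in>UNIV. A $ j $ i) = 1) \<and>
     (\<forall>S. S \<subseteq> rows A \<union> range (\<lambda>i. axis i 1) \<and> card S = CARD('n) - 1 \<longrightarrow>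
          (\<chi> i. 1) \<notin> span S)"

definition packed :: "real^'n::finite^'m::finite \<Rightarrow> real^('n + 'm) \<Rightarrow> bool" where
  "packed A c \<longleftrightarrow> (\<exists>j. outgoing c $ j < (A *v incoming c) $ j)"

definition unpacked_solution ::
    "real^'n::finite^'m::finite \<Rightarrow> real^('n + 'm) \<Rightarrow> real^('n + 'm) \<Rightarrow> bool" where
  "unpacked_solution A c \<gamma> \<longleftrightarrow> \<not> packed A c \<and>
     is_arg_max total_in
       (\<lambda>\<gamma>. \<gamma> \<in> admissible_fluxes c \<and> outgoing \<gamma> = A *v incoming \<gamma>) \<gamma>"

definition right_of_way_fluxes ::
    "real^('n::finite + 'm::finite) \<Rightarrow> real \<Rightarrow> real \<Rightarrow> real^('n + 'm)" where
  "right_of_way_fluxes c lam mu =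
     (\<chi> k. case k of Inl i \<Rightarrow> mu * c $ Inl i | Inr j \<Rightarrow> lam * c $ Inr j)"

definition packed_solution ::
    "real^'n::finite^'m::finite \<Rightarrow> real^('n + 'm) \<Rightarrow> real \<Rightarrow> real \<Rightarrow> real^('n + 'm) \<Rightarrow> bool" where
  "packed_solution A c lam mu \<gamma> \<longleftrightarrow> packed A c \<and>
     is_arg_max (\<lambda>(l, u). total_in (right_of_way_fluxes c l u))
       (\<lambda>(l, u). l \<in> {0..1} \<and> u \<in> {0..1} \<and>
          total_in (right_of_way_fluxes c l u) = total_out (right_of_way_fluxes c l u))
       (lam, mu) \<and>
     \<gamma> = right_of_way_fluxes c lam mu"

definition junction_solution ::
    "real^'n::finite^'m::finite \<Rightarrow> real^('n + 'm) \<Rightarrow> real^('n + 'm) \<Rightarrow> bool" where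
  "junction_solution A c \<gamma> \<longleftrightarrow>
     unpacked_solution A c \<gamma> \<or> (\<exists>lam mu. packed_solution A c lam mu \<gamma>)"

definition load_ratio :: "real^'n::finite^'m::finite \<Rightarrow> real^('n + 'm) \<Rightarrow> 'm \<Rightarrow> real" where
  "load_ratio A c j = inverse (outgoing c $ j) * (row j A \<bullet> incoming c)"

definition max_load_ratio :: "real^'n::finite^'m::finite \<Rightarrow> real^('n + 'm) \<Rightarrow> real" where
  "max_load_ratio A c = (MAX j. load_ratio A c j)"

end

(* If the junction is not packed, the flux with all incoming roads at capacity is admissible, and
   it is the only admissible flux with this total inflow. If it is packed, the Kirchhoff law reads
   mu * c_in = lambda * c_out; with lambda, mu <= 1 this common value is at most min(c_in, c_out),
   which is attained, and it determines both parameters since c_in, c_out > 0. *)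

theory Submission
  imports Defs
begin

text \<open>An upper bound attained at \<open>a\<close> and at no other feasible point settles
  existence and uniqueness of the maximizer in one equivalence. Both optimization problems are
  solved through this rule.\<close>

lemma is_arg_max_iff_eq:
  fixes f :: "'a \<Rightarrow> 'b::linorder"
  assumes "P a" and "\<And>y. P y \<Longrightarrow> f y \<le> f a" and "\<And>y. P y \<Longrightarrow> f y = f a \<Longrightarrow> y = a"
  shows "is_arg_max f P x \<longleftrightarrow> x = a"
  using assms unfolding is_arg_max_linorder by (metis order.antisym)

lemma flux_eq_iff:
  fixes \<gamma> \<gamma>' :: "real^('n::finite + 'm::finite)"
  shows "\<gamma> = \<gamma>' \<longleftrightarrow> incoming \<gamma> = incoming \<gamma>' \<and> outgoing \<gamma> = outgoing \<gamma>'"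
proof
  assume eq: "incoming \<gamma> = incoming \<gamma>' \<and> outgoing \<gamma> = outgoing \<gamma>'"
  have "\<gamma> $ k = \<gamma>' $ k" for k
    using eq by (cases k) (simp_all add: incoming_def outgoing_def vec_eq_iff)
  then show "\<gamma> = \<gamma>'"
    by (simp add: vec_eq_iff)
qed simp

text \<open>The index type is a disjoint sum, so the two halves of a flux vector can be prescribed
  independently and determine it. This turns explicit formulas for the halves into unique
  existence.\<close>

lemma ex1_flux: "\<exists>!\<gamma>. incoming \<gamma> = x \<and> outgoing \<gamma> = y"
proof (rule ex_ex1I)
  have "incoming (\<chi> k. case k of Inl i \<Rightarrow> x $ i | Inr j \<Rightarrow> y $ j) = x \<and>
      outgoing (\<chi> k. case k of Inl i \<Rightarrow> x $ i | Inr j \<Rightarrow> y $ j) = y"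
    by (simp add: incoming_def outgoing_def vec_eq_iff)
  then show "\<exists>\<gamma>. incoming \<gamma> = x \<and> outgoing \<gamma> = y" ..
qed (simp add: flux_eq_iff)

lemma admissible_fluxes_iff:
  fixes \<gamma> c :: "real^('n::finite + 'm::finite)"
  shows "\<gamma> \<in> admissible_fluxes c \<longleftrightarrow>
    (\<forall>i. incoming \<gamma> $ i \<in> {0..incoming c $ i}) \<and> (\<forall>j. outgoing \<gamma> $ j \<in> {0..outgoing c $ j})"
proof
  assume R: "(\<forall>i. incoming \<gamma> $ i \<in> {0..incoming c $ i}) \<and>
    (\<forall>j. outgoing \<gamma> $ j \<in> {0..outgoing c $ j})"
  have "\<gamma> $ k \<in> {0..c $ k}" for k
    using R by (cases k) (simp_all add: incoming_def outgoing_def)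
  then show "\<gamma> \<in> admissible_fluxes c"
    by (simp add: admissible_fluxes_def)
qed (simp add: admissible_fluxes_def incoming_def outgoing_def)

lemma incoming_right_of_way_fluxes [simp]:
  "incoming (right_of_way_fluxes c lam mu) = mu *\<^sub>R incoming c"
  by (simp add: incoming_def right_of_way_fluxes_def vec_eq_iff)

lemma outgoing_right_of_way_fluxes [simp]:
  "outgoing (right_of_way_fluxes c lam mu) = lam *\<^sub>R outgoing c"
  by (simp add: outgoing_def right_of_way_fluxes_def vec_eq_iff)

lemma total_right_of_way_fluxes [simp]:
  "total_in (right_of_way_fluxes c lam mu) = mu * total_in c"
  "total_out (right_of_way_fluxes c lam mu) = lam * total_out c"
  by (simp_all add: total_in_def total_out_def sum_distrib_left)

text \<open>Multiplying by a positive outgoing capacity turns \<open>load_ratio A c j > 1\<close>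
  into overload of road \<open>j\<close>, and a maximum over a finite type exceeds 1 iff some entry
  does. This links the case split of the problem to that of the theorem.\<close>

lemma packed_iff_max_load_ratio:
  fixes A :: "real^'n::finite^'m::finite"
  assumes "\<And>j. 0 < outgoing c $ j"
  shows "packed A c \<longleftrightarrow> 1 < max_load_ratio A c"
proof -
  have "load_ratio A c j > 1 \<longleftrightarrow> outgoing c $ j < (A *v incoming c) $ j" for j
  proof -
    have "row j A \<bullet> incoming c = (A *v incoming c) $ j"
      by (simp add: matrix_vector_mul_component row_def)
    then show ?thesis
      using assms[of j] by (simp add: load_ratio_def field_simps)
  qed
  then show ?thesis
    by (auto simp: packed_def max_load_ratio_def Max_gr_iff)
qed

text \<open>If the total vanished, so would every nonnegative incoming capacity; the demand
  \<open>A *v incoming c\<close> would then be 0 and could not exceed a positive outgoing capacity.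
  Positivity makes division by \<open>total_in c\<close> meaningful in the packed case.\<close>

lemma packed_imp_total_in_pos:
  fixes A :: "real^'n::finite^'m::finite"
  assumes inc: "\<And>i. 0 \<le> incoming c $ i" and out: "\<And>j. 0 < outgoing c $ j"
    and "packed A c"
  shows "0 < total_in c"
proof (rule ccontr)
  assume "\<not> 0 < total_in c"
  moreover have "0 \<le> total_in c"
    unfolding total_in_def by (intro sum_nonneg inc)
  ultimately have "\<forall>i\<in>UNIV. incoming c $ i = 0"
    using sum_nonneg_eq_0_iff[of UNIV "\<lambda>i. incoming c $ i"] inc by (simp add: total_in_def)
  then have "incoming c = 0"
    by (simp add: vec_eq_iff)
  then show False
    using \<open>packed A c\<close> out by (auto simp: packed_def less_le_not_le)
qed

lemma unpacked_solution_iff: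
  fixes A :: "real^'n::finite^'m::finite" and c :: "real^('n + 'm)"
  assumes inc: "\<And>i. 0 \<le> incoming c $ i" and A: "\<And>j i. 0 \<le> A $ j $ i"
  shows "unpacked_solution A c \<gamma> \<longleftrightarrow>
    \<not> packed A c \<and> incoming \<gamma> = incoming c \<and> outgoing \<gamma> = A *v incoming \<gamma>"
proof (cases "packed A c")
  case False
  obtain \<gamma>\<^sub>0 where \<gamma>\<^sub>0: "incoming \<gamma>\<^sub>0 = incoming c" "outgoing \<gamma>\<^sub>0 = A *v incoming c"
    using ex1_flux[of "incoming c" "A *v incoming c"] by blast
  let ?P = "\<lambda>\<gamma>. \<gamma> \<in> admissible_fluxes c \<and> outgoing \<gamma> = A *v incoming \<gamma>"
  have "is_arg_max total_in ?P \<gamma> \<longleftrightarrow> \<gamma> = \<gamma>\<^sub>0"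
  proof (rule is_arg_max_iff_eq)
    have "0 \<le> (A *v incoming c) $ j" for j
      unfolding matrix_vector_mult_def using inc A by (simp add: sum_nonneg)
    \<comment> \<open>Not being packed is exactly the upper bound on the outgoing half of
      \<open>\<gamma>\<^sub>0\<close>.\<close>
    then show "?P \<gamma>\<^sub>0"
      using False inc by (auto simp: admissible_fluxes_iff \<gamma>\<^sub>0 packed_def not_less)
  next
    fix \<delta> assume "?P \<delta>"
    then show "total_in \<delta> \<le> total_in \<gamma>\<^sub>0"
      unfolding total_in_def \<gamma>\<^sub>0 by (intro sum_mono) (simp add: admissible_fluxes_iff)
  next
    fix \<delta> assume \<delta>: "?P \<delta>" and eq: "total_in \<delta> = total_in \<gamma>\<^sub>0"
    \<comment> \<open>Each summand is at most the corresponding capacity, so equal sums force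
      equality term by term.\<close>
    have "incoming \<delta> $ i = incoming c $ i" for i
      using sum_mono_inv[OF eq[unfolded total_in_def \<gamma>\<^sub>0]] \<delta> by (simp add: admissible_fluxes_iff)
    then have "incoming \<delta> = incoming c"
      by (simp add: vec_eq_iff)
    then show "\<delta> = \<gamma>\<^sub>0"
      using \<delta> by (simp add: flux_eq_iff \<gamma>\<^sub>0)
  qed
  then show ?thesis
    using False by (auto simp: unpacked_solution_def flux_eq_iff \<gamma>\<^sub>0)
qed (simp add: unpacked_solution_def)

text \<open>\<open>K\<close> is the largest throughput compatible with both total capacities.
  Writing the parameters through this minimum treats both orderings of the totals at once.\<close>

lemma packed_solution_iff:
  fixes A :: "real^'n::finite^'m::finite" and c :: "real^('n + 'm)"
  assumes inc: "\<And>i. 0 \<le> incoming c $ i" and out: "\<And>j. 0 < outgoing c $ j"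
  defines "K \<equiv> min (total_in c) (total_out c)"
  shows "packed_solution A c lam mu \<gamma> \<longleftrightarrow>
    packed A c \<and> lam = K / total_out c \<and> mu = K / total_in c \<and>
    incoming \<gamma> = mu *\<^sub>R incoming c \<and> outgoing \<gamma> = lam *\<^sub>R outgoing c"
proof (cases "packed A c")
  case True
  have ci: "0 < total_in c"
    using packed_imp_total_in_pos[OF inc out True] .
  have co: "0 < total_out c"
    unfolding total_out_def by (intro sum_pos out) auto
  have "is_arg_max (\<lambda>(l, u). total_in (right_of_way_fluxes c l u))
      (\<lambda>(l, u). l \<in> {0..1} \<and> u \<in> {0..1} \<and>
         total_in (right_of_way_fluxes c l u) = total_out (right_of_way_fluxes c l u)) (lam, mu)
    \<longleftrightarrow> (lam, mu) = (K / total_out c, K / total_in c)"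
  proof (rule is_arg_max_iff_eq, goal_cases)
    case 1
    \<comment> \<open>Feasibility: \<open>K\<close> lies between 0 and each of the positive totals,
      so both quotients are in the unit interval, and both sides of the Kirchhoff law equal
      \<open>K\<close>.\<close>
    show ?case
      using ci co by (simp add: K_def)
  next
    case (2 y)
    obtain l u where y: "y = (l, u)"
      by fastforce
    have "u * total_in c \<le> 1 * total_in c" "l * total_out c \<le> 1 * total_out c"
      by (rule mult_right_mono; use 2 y ci co in simp)+
    moreover have "u * total_in c = l * total_out c"
      using 2 y by simp
    ultimately have "u * total_in c \<le> K"
      by (simp add: K_def)
    then show ?case
      using y ci by simp
  next
    case (3 y)
    \<comment> \<open>A tie means \<open>u * total_in c = K\<close>, and then the Kirchhoff law
      gives \<open>l * total_out c = K\<close>; dividing by the positive totals recovers both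
      parameters.\<close>
    then show ?case
      using ci co by (cases y) (simp add: field_simps)
  qed
  then show ?thesis
    using True by (auto simp: packed_solution_def flux_eq_iff)
qed (simp add: packed_solution_def)

theorem theorem2p1:
  fixes A :: "real^'n::finite^'m::finite" and c :: "real^('n + 'm)"
  assumes c_incoming: "\<And>i. 0 \<le> incoming c $ i"
    and c_outgoing: "\<And>j. 0 < outgoing c $ j"
    and A: "traffic_distribution_matrix A"
  shows "(\<exists>!\<gamma>. junction_solution A c \<gamma>) \<and>
    (packed A c \<longrightarrow> (\<exists>!(lam, mu, \<gamma>). packed_solution A c lam mu \<gamma>)) \<and>
    (max_load_ratio A c \<le> 1 \<longrightarrow>
      (\<forall>\<gamma>. junction_solution A c \<gamma> \<longleftrightarrow>
         incoming \<gamma> = incoming c \<and> outgoing \<gamma> = A *v incoming \<gamma>)) \<and>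
    (max_load_ratio A c > 1 \<and> total_in c \<le> total_out c \<longrightarrow>
      (\<forall>\<gamma>. junction_solution A c \<gamma> \<longleftrightarrow>
         incoming \<gamma> = incoming c \<and>
         outgoing \<gamma> = (total_in c / total_out c) *\<^sub>R outgoing c) \<and>
      (\<forall>lam mu \<gamma>. packed_solution A c lam mu \<gamma> \<longleftrightarrow>
         mu = 1 \<and> lam = total_in c / total_out c \<and>
         incoming \<gamma> = incoming c \<and>
         outgoing \<gamma> = (total_in c / total_out c) *\<^sub>R outgoing c)) \<and>
    (max_load_ratio A c > 1 \<and> total_in c > total_out c \<longrightarrow>
      (\<forall>\<gamma>. junction_solution A c \<gamma> \<longleftrightarrow>
         incoming \<gamma> = (total_out c / total_in c) *\<^sub>R incoming c \<and>
         outgoing \<gamma> = outgoing c) \<and>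
      (\<forall>lam mu \<gamma>. packed_solution A c lam mu \<gamma> \<longleftrightarrow>
         mu = total_out c / total_in c \<and> lam = 1 \<and>
         incoming \<gamma> = (total_out c / total_in c) *\<^sub>R incoming c \<and>
         outgoing \<gamma> = outgoing c))"
proof -
  have A_nonneg: "0 \<le> A $ j $ i" for j i
    using A by (simp add: traffic_distribution_matrix_def less_imp_le)
  note unpacked = unpacked_solution_iff[OF c_incoming A_nonneg]
  note packed = packed_solution_iff[OF c_incoming c_outgoing]
  note packed_iff = packed_iff_max_load_ratio[OF c_outgoing]
  have co: "0 < total_out c"
    unfolding total_out_def by (intro sum_pos c_outgoing) auto
  have ci: "0 < total_in c" if "packed A c"
    using packed_imp_total_in_pos[OF c_incoming c_outgoing that] .
  have unpacked_case: "junction_solution A c \<gamma> \<longleftrightarrow>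
      incoming \<gamma> = incoming c \<and> outgoing \<gamma> = A *v incoming \<gamma>" if "\<not> packed A c" for \<gamma>
    using that by (auto simp: junction_solution_def unpacked packed)
  have packed_case: "junction_solution A c \<gamma> \<longleftrightarrow>
      incoming \<gamma> = (min (total_in c) (total_out c) / total_in c) *\<^sub>R incoming c \<and>
      outgoing \<gamma> = (min (total_in c) (total_out c) / total_out c) *\<^sub>R outgoing c"
    if "packed A c" for \<gamma>
    using that by (auto simp: junction_solution_def unpacked packed)
  have "\<exists>!\<gamma>. junction_solution A c \<gamma>"
  proof (cases "packed A c")
    case True
    show ?thesis
      unfolding packed_case[OF True] by (rule ex1_flux)
  next
    case False
    \<comment> \<open>The right-hand side uses \<open>incoming c\<close> instead of
      \<open>incoming \<gamma>\<close>, so that both halves are prescribed independently of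
      \<open>\<gamma>\<close>, as \<open>ex1_flux\<close> requires.\<close>
    then have "junction_solution A c \<gamma> \<longleftrightarrow>
        incoming \<gamma> = incoming c \<and> outgoing \<gamma> = A *v incoming c" for \<gamma>
      by (auto simp: unpacked_case)
    then show ?thesis
      by (simp only: ex1_flux)
  qed
  moreover have "\<exists>!(lam, mu, \<gamma>). packed_solution A c lam mu \<gamma>" if "packed A c"
  proof -
    let ?K = "min (total_in c) (total_out c)"
    let ?l = "?K / total_out c" and ?u = "?K / total_in c"
    show ?thesis
    proof (rule ex1I[of _ "(?l, ?u, right_of_way_fluxes c ?l ?u)"])
      show "case (?l, ?u, right_of_way_fluxes c ?l ?u) of (lam, mu, \<gamma>) \<Rightarrow>
          packed_solution A c lam mu \<gamma>"
        using that by (simp add: packed)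
    next
      fix z assume "case z of (lam, mu, \<gamma>) \<Rightarrow> packed_solution A c lam mu \<gamma>"
      then show "z = (?l, ?u, right_of_way_fluxes c ?l ?u)"
        by (cases z) (simp add: packed flux_eq_iff)
    qed
  qed
  moreover have "junction_solution A c \<gamma> \<longleftrightarrow>
      incoming \<gamma> = incoming c \<and> outgoing \<gamma> = A *v incoming \<gamma>" if "max_load_ratio A c \<le> 1" for \<gamma>
    using that by (simp add: unpacked_case packed_iff)
  moreover have "(junction_solution A c \<gamma> \<longleftrightarrow> incoming \<gamma> = incoming c \<and>
        outgoing \<gamma> = (total_in c / total_out c) *\<^sub>R outgoing c) \<and>
      (packed_solution A c lam mu \<gamma> \<longleftrightarrow> mu = 1 \<and> lam = total_in c / total_out c \<and>
        incoming \<gamma> = incoming c \<and> outgoing \<gamma> = (total_in c / total_out c) *\<^sub>R outgoing c)"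
    if "max_load_ratio A c > 1" "total_in c \<le> total_out c" for lam mu \<gamma>
  proof -
    have p: "packed A c"
      using that by (simp add: packed_iff)
    show ?thesis
      \<comment> \<open>Here the minimum is \<open>total_in c\<close>, and its positivity cancels
        the quotient for \<open>mu\<close> to 1.\<close>
      using p ci[OF p] that(2) by (auto simp: packed_case packed min_absorb1)
  qed
  moreover have "(junction_solution A c \<gamma> \<longleftrightarrow>
        incoming \<gamma> = (total_out c / total_in c) *\<^sub>R incoming c \<and> outgoing \<gamma> = outgoing c) \<and>
      (packed_solution A c lam mu \<gamma> \<longleftrightarrow> mu = total_out c / total_in c \<and> lam = 1 \<and>
        incoming \<gamma> = (total_out c / total_in c) *\<^sub>R incoming c \<and> outgoing \<gamma> = outgoing c)"
    if "max_load_ratio A c > 1" "total_in c > total_out c" for lam mu \<gamma>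
  proof -
    have p: "packed A c"
      using that by (simp add: packed_iff)
    show ?thesis
      \<comment> \<open>Here the minimum is \<open>total_out c\<close>, so it is the quotient for
        \<open>lam\<close> that cancels to 1.\<close>
      using p co that(2) by (auto simp: packed_case packed min_absorb2)
  qed
  ultimately show ?thesis
    by (intro conjI impI allI; (elim conjE)?; simp only:)
qed

end
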